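(* Let $m\ge3$ be an integer and $n=\frac{3^m-1}{2}$. Let $\beta$ be a primitive $2n$-th root of unity in an extension field of $\mathrm{GF}(3)$ and let $\mathbb{M}_{\beta^i}(x)$ denote the minimal polynomial of $\beta^i$ over $\mathrm{GF}(3)$. Let $\mathcal{C}(m)$ be the ternary negacyclic code of length $n$ with check polynomial $\mathrm{lcm}(\mathbb{M}_\beta(x),\mathbb{M}_{\beta^{2n-1}}(x))$. Then $\mathcal{C}(m)$ has parameters $[n,2m,d]$ with $d\ge\frac{3^{m-1}-1}{2}$, and $\mathcal{C}(m)^\perp$ has parameters $[n,n-2m,5]$.
   Context: A ternary negacyclic code of length $n$ is an ideal of $\mathrm{GF}(3)[x]/(x^n+1)$; a code with check polynomial $h(x)$ (a monic divisor of $x^n+1$) is the one with generator polynomial $(x^n+1)/h(x)$. $[n,k,d]$ denotes length, dimension, minimum Hamming distance; $\perp$ is the Euclidean dual. *)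

theory Defs
  imports "Berlekamp_Zassenhaus.Finite_Field" "HOL-Computational_Algebra.Polynomial"
begin

typedef three = "{0::nat, 1, 2}" by auto

lemma card_three: "CARD(three) = 3"
proof -
  have "CARD(three) = card {0::nat, 1, 2}"
    using type_definition.card[OF type_definition_three] by simp
  then show ?thesis by simp
qed

instance three :: finite
proof
  show "finite (UNIV :: three set)"
    using type_definition.Rep_range[OF type_definition_three]
    by (metis finite.emptyI finite_imageD finite_insert inj_on_def Rep_three_inject)
qed

instance three :: prime_card
  by standard (simp add: card_three)

type_synonym gf3 = "three mod_ring"

definition emb3 :: "gf3 \<Rightarrow> 'f::field" where
  "emb3 a = of_int (to_int_mod_ring a)"

definition min_poly3 :: "'f::field \<Rightarrow> gf3 poly" where
  "min_poly3 a = (THE p. monic p \<and> poly (map_poly emb3 p) a = 0 \<and>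
      (\<forall>q. q \<noteq> 0 \<longrightarrow> poly (map_poly emb3 q) a = 0 \<longrightarrow> degree p \<le> degree q))"

text \<open>Codewords of length n are represented as polynomials of degree < n
  (coefficient vectors (c_0, ..., c_{n-1})), i.e. elements of GF(3)[x]/(x^n+1).\<close>

definition negacyclic_code :: "nat \<Rightarrow> gf3 poly \<Rightarrow> gf3 poly set" where
  "negacyclic_code n h = {(f * ((monom 1 n + 1) div h)) mod (monom 1 n + 1) | f. True}"

definition hamming_dist :: "nat \<Rightarrow> gf3 poly \<Rightarrow> gf3 poly \<Rightarrow> nat" where
  "hamming_dist n c c' = card {i. i < n \<and> coeff c i \<noteq> coeff c' i}"

definition min_dist :: "nat \<Rightarrow> gf3 poly set \<Rightarrow> nat" where
  "min_dist n C = Min {hamming_dist n c c' | c c'. c \<in> C \<and> c' \<in> C \<and> c \<noteq> c'}"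

definition code_dim :: "gf3 poly set \<Rightarrow> nat" where
  "code_dim C = vector_space.dim (smult :: gf3 \<Rightarrow> gf3 poly \<Rightarrow> gf3 poly) C"

definition dual_code :: "nat \<Rightarrow> gf3 poly set \<Rightarrow> gf3 poly set" where
  "dual_code n C = {c. degree c < n \<and> (\<forall>c'\<in>C. (\<Sum>i<n. coeff c i * coeff c' i) = 0)}"

end

theory Submission
  imports Defs
begin

text \<open>Let \<open>Z\<close> be the set of the \<open>2m\<close> conjugates of \<open>\<beta>\<close> and \<open>\<beta>\<^sup>-\<^sup>1\<close>, the roots of the check
  polynomial \<open>h\<close>. Its degree is at least \<open>2m\<close> because it vanishes on \<open>Z\<close>, and at most \<open>2m\<close> because
  the \<open>3\<^bsup>2m+1\<^esup>\<close> polynomials of degree at most \<open>2m\<close> have only \<open>3\<^bsup>2m\<^esup>\<close> possible pairs of values at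
  \<open>\<beta>\<close> and \<open>\<beta>\<^sup>-\<^sup>1\<close>.
  The code consists of the words vanishing at the odd powers of \<open>\<beta>\<close> outside \<open>Z\<close>; discrete Fourier
  inversion shows that its dual consists of the words vanishing on \<open>Z\<close>. The BCH bound, applied to
  the odd exponents strictly between \<open>3\<^bsup>m-1\<^esup>\<close> and \<open>2 \<cdot> 3\<^bsup>m-1\<^esup> - 1\<close> and to the exponents
  \<open>-3, -1, 1, 3\<close> respectively, gives both lower bounds on the minimum distance. A sphere-packing
  count yields a dual codeword of weight at most five.\<close>

section \<open>Vandermonde systems and multiples of a polynomial\<close>

text \<open>By linearity the moments give zero against every polynomial of degree below
  \<open>card S\<close>. Testing with the product of linear factors that vanishes at every node
  except \<open>x s0\<close> isolates \<open>A s0\<close>.\<close>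

lemma vandermonde_kernel_trivial:
  fixes x A :: "'a \<Rightarrow> 'b::field"
  assumes fin: "finite S" and inj: "inj_on x S"
    and moments: "\<And>j. j < card S \<Longrightarrow> (\<Sum>s\<in>S. A s * x s ^ j) = 0"
    and s0: "s0 \<in> S"
  shows "A s0 = 0"
proof -
  define p where "p = (\<Prod>s\<in>S - {s0}. [:- x s, 1:])"
  have "degree p \<le> (\<Sum>s\<in>S - {s0}. degree [:- x s, 1:])"
    unfolding p_def using degree_prod_sum_le[of "S - {s0}" "\<lambda>s. [:- x s, 1:]"] fin
    by (simp add: o_def)
  also have "\<dots> = card (S - {s0})" by simp
  also have "\<dots> < card S" using fin s0 by (rule card_Diff1_less)
  finally have deg: "degree p < card S" .
  have p_s: "poly p (x s) = 0 \<longleftrightarrow> s \<noteq> s0" if "s \<in> S" for s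
    using that fin s0 inj by (auto simp: p_def poly_prod inj_on_def)
  have "(\<Sum>s\<in>S. A s * poly p (x s)) = (\<Sum>s\<in>S. \<Sum>j\<le>degree p. coeff p j * (A s * x s ^ j))"
    by (simp add: poly_altdef sum_distrib_left algebra_simps)
  also have "\<dots> = (\<Sum>j\<le>degree p. coeff p j * (\<Sum>s\<in>S. A s * x s ^ j))"
    by (subst sum.swap) (simp add: sum_distrib_left)
  also have "\<dots> = 0" using moments deg by (intro sum.neutral) auto
  finally have "(\<Sum>s\<in>S. A s * poly p (x s)) = 0" .
  moreover have "(\<Sum>s\<in>S. A s * poly p (x s)) = A s0 * poly p (x s0)"
    using fin s0 p_s by (subst sum.remove[of _ s0]) (auto intro!: sum.neutral)
  ultimately show ?thesis using p_s[OF s0] by simp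
qed

section \<open>Codes as spaces of multiples of a polynomial\<close>

lemma coeff_sum_monom_lessThan:
  "coeff (\<Sum>j<k. monom (a j) j) i = (if i < k then a i else 0)"
  by (simp add: coeff_sum)

lemma poly_eq_sum_monom_lessThan:
  assumes "\<And>i. i \<ge> k \<Longrightarrow> coeff q i = 0"
  shows "q = (\<Sum>j<k. monom (coeff q j) j)"
  using assms by (intro poly_eqI) (auto simp: coeff_sum_monom_lessThan)

text \<open>The shifts of \<open>p\<close> by \<open>x^j\<close> with
  \<open>j < n - degree p\<close> form a basis: the coordinates of a multiple of \<open>p\<close>
  are the coefficients of its quotient.\<close>

lemma code_dim_multiples:
  assumes p: "p \<noteq> 0" and n: "n > 0"
  shows "code_dim {c. p dvd c \<and> degree c < n} = n - degree p"
proof -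
  interpret vs: vector_space "smult :: gf3 \<Rightarrow> gf3 poly \<Rightarrow> gf3 poly"
    by unfold_locales (auto simp: smult_add_right smult_add_left)
  define k where "k = n - degree p"
  define b where "b j = p * monom 1 j" for j
  have inj: "inj_on b {..<k}"
    using p by (auto simp: inj_on_def b_def monom_eq_iff')
  have comb: "(\<Sum>j<k. smult (a j) (b j)) = p * (\<Sum>j<k. monom (a j) j)" for a
    by (simp add: b_def sum_distrib_left smult_monom flip: mult_smult_right)
  show ?thesis unfolding code_dim_def k_def[symmetric]
  proof (rule vs.dim_unique)
    show "b ` {..<k} \<subseteq> {c. p dvd c \<and> degree c < n}"
      using p by (auto simp: b_def k_def degree_mult_eq degree_monom_eq)
    show "card (b ` {..<k}) = k" using inj by (simp add: card_image)
    show "{c. p dvd c \<and> degree c < n} \<subseteq> vs.span (b ` {..<k})"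
    proof safe
      fix c assume "p dvd c" and deg: "degree c < n"
      then obtain q where c: "c = p * q" by blast
      have "coeff q i = 0" if "i \<ge> k" for i
      \<comment> \<open>The zero quotient is set apart because its degree is 0 by convention, which
        is not below \<open>k\<close> when \<open>k = 0\<close>.\<close>
      proof (cases "q = 0")
        case False
        then have "degree q < k" using deg p by (simp add: c k_def degree_mult_eq)
        then show ?thesis using that by (simp add: coeff_eq_0)
      qed simp
      then have c_eq: "c = (\<Sum>j<k. smult (coeff q j) (b j))"
        unfolding comb c using poly_eq_sum_monom_lessThan[of k q] by metis
      show "c \<in> vs.span (b ` {..<k})"
        unfolding c_eq by (intro vs.span_sum vs.span_scale vs.span_base imageI)
    qed
    show "\<not> vs.dependent (b ` {..<k})"
    proof (rule vs.independent_if_scalars_zero)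
      fix f x assume "(\<Sum>x\<in>b ` {..<k}. smult (f x) x) = 0" and x: "x \<in> b ` {..<k}"
      then have "(\<Sum>j<k. smult (f (b j)) (b j)) = 0"
        using inj by (simp add: sum.reindex o_def)
      then have "(\<Sum>j<k. monom (f (b j)) j) = 0" using p unfolding comb by simp
      then have "\<forall>i. coeff (\<Sum>j<k. monom (f (b j)) j) i = 0" by simp
      then show "f x = 0" using x unfolding coeff_sum_monom_lessThan by (metis imageE lessThan_iff)
    qed simp
  qed
qed

text \<open>The generator divides \<open>x^n + 1\<close>, so reduction preserves divisibility by it;
  conversely, a word of degree below \<open>n\<close> is its own remainder.\<close>

lemma negacyclic_code_eq_multiples:
  assumes n: "n > 0" and h: "h dvd monom 1 n + 1"
  shows "negacyclic_code n h = {c. (monom 1 n + 1) div h dvd c \<and> degree c < n}"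
proof -
  let ?x = "monom 1 n + 1 :: gf3 poly"
  let ?g = "?x div h"
  have deg: "degree ?x = n" using n
    by (subst degree_add_eq_left) (auto simp: degree_monom_eq)
  have g: "?g dvd ?x" using h by (metis dvd_div_mult_self dvd_triv_left)
  have x0: "?x \<noteq> 0" using deg n by auto
  show ?thesis unfolding negacyclic_code_def
  proof safe
    fix f
    show "?g dvd f * ?g mod ?x" using g by (simp add: dvd_mod)
    show "degree (f * ?g mod ?x) < n" using degree_mod_less'[OF x0] deg n
      by (metis degree_0)
  next
    fix c assume "?g dvd c" "degree c < n"
    then show "\<exists>f. c = f * ?g mod ?x \<and> True"
      using deg by (metis dvd_div_mult_self mod_poly_less)
  qed
qed

section \<open>Minimum distance\<close>

lemma finite_hamming_dists: "finite {hamming_dist n c c' | c c'. c \<in> C \<and> c' \<in> C \<and> c \<noteq> c'}"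
proof (rule finite_subset)
  have "hamming_dist n c c' \<le> card {..<n}" for c c'
    unfolding hamming_dist_def by (intro card_mono) auto
  then show "{hamming_dist n c c' | c c'. c \<in> C \<and> c' \<in> C \<and> c \<noteq> c'} \<subseteq> {..n}"
    by auto
qed simp

lemma hamming_dist_eq_weight: "hamming_dist n c c' = card {i. i < n \<and> coeff (c - c') i \<noteq> 0}"
  by (simp add: hamming_dist_def)

text \<open>The code is closed under subtraction, so its distances are weights of nonzero codewords.
  The words \<open>p\<close> and 0 make the set of distances nonempty, so that \<open>Min\<close> is
  meaningful.\<close>

lemma min_dist_ge:
  assumes "\<And>c. p dvd c \<Longrightarrow> degree c < n \<Longrightarrow> c \<noteq> 0 \<Longrightarrow> d \<le> card {i. i < n \<and> coeff c i \<noteq> 0}"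
    and "p \<noteq> 0" "degree p < n"
  shows "d \<le> min_dist n {c. p dvd c \<and> degree c < n}"
  unfolding min_dist_def
proof (subst Min_ge_iff[OF finite_hamming_dists])
  let ?C = "{c. p dvd c \<and> degree c < n}"
  have "p \<in> ?C" "0 \<in> ?C" using assms by auto
  then show "{hamming_dist n c c' | c c'. c \<in> ?C \<and> c' \<in> ?C \<and> c \<noteq> c'} \<noteq> {}"
    using \<open>p \<noteq> 0\<close> by blast
  show "\<forall>a\<in>{hamming_dist n c c' | c c'. c \<in> ?C \<and> c' \<in> ?C \<and> c \<noteq> c'}. d \<le> a"
    by (auto simp: hamming_dist_eq_weight simp del: coeff_diff
        intro!: assms(1) dvd_diff degree_diff_less)
qed

lemma min_dist_le:
  assumes "c \<in> C" "c' \<in> C" "c \<noteq> c'" "hamming_dist n c c' \<le> d"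
  shows "min_dist n C \<le> d"
proof -
  have "min_dist n C \<le> hamming_dist n c c'"
    unfolding min_dist_def using assms by (intro Min_le finite_hamming_dists) blast
  then show ?thesis using assms by simp
qed

section \<open>Evaluation in a field of characteristic three\<close>

text \<open>As \<open>3 ^ m - 1\<close> equals \<open>2n\<close>, the last two assumptions say that
  \<open>\<beta>\<close> is a primitive \<open>2n\<close>-th root of unity.\<close>

locale primitive_root_char3 =
  fixes m :: nat and \<beta> :: "'f::field"
  assumes m_ge_3: "m \<ge> 3"
    and char_3: "CHAR('f) = 3"
    and root_power: "\<beta> ^ (3 ^ m - 1) = 1"
    and root_order: "\<And>k. 0 < k \<Longrightarrow> k < 3 ^ m - 1 \<Longrightarrow> \<beta> ^ k \<noteq> 1"
begin

lemma of_int_mod_3: "of_int (k mod 3) = (of_int k :: 'f)"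
proof -
  have "(of_int (k - k mod 3) :: 'f) = 0"
    unfolding of_int_eq_0_iff_char_dvd char_3 by (simp add: minus_mod_eq_mult_div)
  then show ?thesis by simp
qed

sublocale emb3: field_hom "emb3 :: gf3 \<Rightarrow> 'f"
  by unfold_locales
    (simp_all add: emb3_def to_int_mod_ring_add to_int_mod_ring_mult card_three of_int_mod_3)

sublocale emb3_poly: map_poly_inj_idom_hom "emb3 :: gf3 \<Rightarrow> 'f" ..

abbreviation ev :: "gf3 poly \<Rightarrow> 'f \<Rightarrow> 'f" where
  "ev p x \<equiv> poly (map_poly emb3 p) x"

lemma ev_simps [simp]:
  "ev 0 x = 0" "ev 1 x = 1" "ev (p + q) x = ev p x + ev q x" "ev (p - q) x = ev p x - ev q x"
  "ev (p * q) x = ev p x * ev q x" "ev (monom a i) x = emb3 a * x ^ i"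
  by (simp_all add: hom_distribs poly_monom)

lemma ev_dvd: "p dvd q \<Longrightarrow> ev p x = 0 \<Longrightarrow> ev q x = 0"
  by (auto elim!: dvdE)

lemma ev_altdef:
  assumes "degree p < k"
  shows "ev p x = (\<Sum>i<k. emb3 (coeff p i) * x ^ i)"
proof -
  have "p = (\<Sum>j<k. monom (coeff p j) j)"
    using assms by (intro poly_eq_sum_monom_lessThan) (simp add: coeff_eq_0)
  then have "ev p x = ev (\<Sum>j<k. monom (coeff p j) j) x" by simp
  also have "\<dots> = (\<Sum>i<k. emb3 (coeff p i) * x ^ i)"
    by (simp add: hom_distribs poly_sum poly_monom)
  finally show ?thesis .
qed

lemma card_ev_roots:
  assumes "p \<noteq> 0"
  shows "finite {x. ev p x = 0}" "card {x. ev p x = 0} \<le> degree p"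
proof -
  have "map_poly emb3 p \<noteq> (0 :: 'f poly)" using assms by simp
  then show "finite {x. ev p x = 0}" "card {x. ev p x = 0} \<le> degree p"
    using poly_roots_finite card_poly_roots_bound[of "map_poly emb3 p :: 'f poly"] by auto
qed

text \<open>Cubing is additive in characteristic three and fixes the embedded elements of
  GF(3).\<close>

lemma ev_cube: "ev p x ^ 3 = ev p (x ^ 3)"
proof (induction p)
  case (pCons a p)
  have "to_int_mod_ring a \<in> {0..<int CARD(three)}"
    using range_to_int_mod_ring by blast
  then have "to_int_mod_ring a = 0 \<or> to_int_mod_ring a = 1 \<or> to_int_mod_ring a = 2"
    unfolding card_three atLeastLessThan_iff by linarith
  \<comment> \<open>This is the cube of the representative 2; the representatives 0 and 1 are fixed
    by cubing anyway.\<close>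
  moreover have "(8 :: 'f) = 2"
    using of_int_mod_3[of 8] by simp
  ultimately have "(emb3 a :: 'f) ^ 3 = emb3 a" by (auto simp: emb3_def)
  moreover have "(emb3 a + x * ev p x) ^ 3 = emb3 a ^ 3 + (x * ev p x) ^ 3"
    by (rule freshmans_dream) (simp_all add: char_3)
  ultimately show ?case using pCons by (simp add: power_mult_distrib)
qed simp

lemma ev_frobenius: "ev p x ^ (3 ^ k) = ev p (x ^ (3 ^ k))"
proof (induction k)
  case (Suc k)
  have "ev p x ^ (3 ^ Suc k) = (ev p x ^ (3 ^ k)) ^ 3"
    by (simp add: mult.commute flip: power_mult)
  also have "\<dots> = ev p (x ^ (3 ^ Suc k))"
    by (simp add: Suc ev_cube mult.commute flip: power_mult)
  finally show ?case .
qed simp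

text \<open>The description defining \<open>min_poly3\<close> denotes only if exactly one polynomial
  fits. The annihilator \<open>q0\<close> gives existence by least degree; division with remainder
  then gives the equivalence.\<close>

lemma min_poly3_dvd_iff:
  assumes ex: "q0 \<noteq> 0" "ev q0 a = 0"
  shows "min_poly3 a dvd q \<longleftrightarrow> ev q a = 0"
proof -
  define P where "P p \<longleftrightarrow> monic p \<and> ev p a = 0 \<and>
    (\<forall>q. q \<noteq> 0 \<longrightarrow> ev q a = 0 \<longrightarrow> degree p \<le> degree q)" for p
  have "\<exists>p. p \<noteq> 0 \<and> ev p a = 0 \<and> (\<forall>q. q \<noteq> 0 \<and> ev q a = 0 \<longrightarrow> degree p \<le> degree q)"
    using ex_has_least_nat[of "\<lambda>p. p \<noteq> 0 \<and> ev p a = 0" q0 degree] ex by metis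
  then obtain p where p: "p \<noteq> 0" "ev p a = 0"
    and least: "\<And>q. q \<noteq> 0 \<Longrightarrow> ev q a = 0 \<Longrightarrow> degree p \<le> degree q" by blast
  have "P (smult (inverse (lead_coeff p)) p)"
    using p least by (auto simp: P_def hom_distribs)
  moreover have "p1 = p2" if "P p1" "P p2" for p1 p2
  proof (rule ccontr)
    assume ne: "p1 \<noteq> p2"
    have deg: "degree p1 = degree p2"
      using that unfolding P_def by (metis antisym leading_coeff_0_iff zero_neq_one)
    have "ev (p1 - p2) a = 0" using that by (simp add: P_def)
    then have "degree p1 \<le> degree (p1 - p2)" using that ne by (simp add: P_def)
    \<comment> \<open>Minimality forces the difference to have the common degree of
      \<open>p1\<close> and \<open>p2\<close>, yet their leading terms cancel.\<close>
    then have "coeff (p1 - p2) (degree p1) \<noteq> 0"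
      using ne deg degree_diff_le[of p1 "degree p1" p2]
      by (metis antisym leading_coeff_0_iff order_refl right_minus_eq)
    then show False using that deg by (simp add: P_def)
  qed
  ultimately have "P (min_poly3 a)"
    unfolding min_poly3_def P_def[symmetric] by (metis theI)
  then have mp: "monic (min_poly3 a)" "ev (min_poly3 a) a = 0"
    and mp_least: "\<And>q. q \<noteq> 0 \<Longrightarrow> ev q a = 0 \<Longrightarrow> degree (min_poly3 a) \<le> degree q"
    by (auto simp: P_def)
  show ?thesis
  proof
    assume "ev q a = 0"
    have "ev q a = ev (q div min_poly3 a * min_poly3 a) a + ev (q mod min_poly3 a) a"
      by (metis ev_simps(3) div_mult_mod_eq)
    then have "ev (q mod min_poly3 a) a = 0" using mp \<open>ev q a = 0\<close> by simp
    moreover have "min_poly3 a \<noteq> 0" using mp by auto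
    ultimately show "min_poly3 a dvd q"
      using mp_least[of "q mod min_poly3 a"] degree_mod_less'[of "min_poly3 a" q]
      by (metis dvd_eq_mod_eq_0 not_le)
  qed (use mp ev_dvd in blast)
qed

section \<open>Roots of unity\<close>

definition n :: nat where "n = (3 ^ m - 1) div 2"

lemma pow3_m: "3 ^ m = 2 * n + 1"
proof -
  have "odd (3 ^ m :: nat)" by simp
  then show ?thesis unfolding n_def by (auto elim!: oddE)
qed

lemma n_ge_13: "n \<ge> 13"
proof -
  have "(3 :: nat) ^ 3 \<le> 3 ^ m" using m_ge_3 by (intro power_increasing) auto
  then show ?thesis using pow3_m by simp
qed

lemma m_less_n: "2 * m < n"
proof -
  have "4 * k + 1 < (3 :: nat) ^ k" if "k \<ge> 3" for k
    using that by (induction k rule: dec_induct) auto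
  from this[of m] show ?thesis using pow3_m m_ge_3 by simp
qed

lemma pow3_pred_m: "3 * 3 ^ (m - 1) = 2 * n + 1"
  using pow3_m m_ge_3 by (cases m) auto

lemma root_power_2n: "\<beta> ^ (2 * n) = 1"
  using root_power pow3_m by simp

lemma root_nonzero: "\<beta> \<noteq> 0"
proof
  assume "\<beta> = 0"
  then show False using root_power_2n n_ge_13 by (simp add: power_0_left)
qed

lemma root_not_1: "0 < k \<Longrightarrow> k < 2 * n \<Longrightarrow> \<beta> ^ k \<noteq> 1"
  using root_order[of k] pow3_m by simp

lemma root_power_inj:
  assumes "\<beta> ^ i = \<beta> ^ j" "i < 2 * n" "j < 2 * n"
  shows "i = j"
proof -
  have "\<not> a < b" if "\<beta> ^ a = \<beta> ^ b" "b < 2 * n" for a b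
  proof
    assume "a < b"
    then have "\<beta> ^ b = \<beta> ^ a * \<beta> ^ (b - a)" by (simp flip: power_add)
    then have "\<beta> ^ (b - a) = 1" using that root_nonzero by simp
    then show False using root_not_1[of "b - a"] that \<open>a < b\<close> by simp
  qed
  from this[of i j] this[of j i] show ?thesis using assms by simp
qed

lemma root_power_n: "\<beta> ^ n = - 1"
proof -
  have "(\<beta> ^ n)\<^sup>2 = 1" using root_power_2n by (simp add: mult.commute flip: power_mult)
  then show ?thesis using root_not_1[of n] n_ge_13 by (simp add: power2_eq_1_iff)
qed

lemma inverse_root: "inverse \<beta> = \<beta> ^ (2 * n - 1)"
proof -
  have "\<beta> * \<beta> ^ (2 * n - 1) = 1"
    using root_power_2n n_ge_13 by (simp flip: power_Suc)
  then show ?thesis by (simp add: inverse_unique)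
qed

lemma root_power_pow3_m: "\<beta> ^ (3 ^ m) = \<beta>"
  using root_power_2n by (simp add: pow3_m)

text \<open>Pigeonhole: both values are fixed by the \<open>m\<close>-fold Frobenius map, so they
  are roots of \<open>X^(3^m) - X\<close>, of which there are at most \<open>3^m\<close>. This
  serves both the degree of \<open>h\<close> and the light dual word.\<close>

lemma syndrome_collision:
  fixes Q :: "'b \<Rightarrow> gf3 poly"
  assumes "finite T" "card T > 3 ^ (2 * m)"
  shows "\<exists>s\<in>T. \<exists>t\<in>T. s \<noteq> t \<and> ev (Q s) \<beta> = ev (Q t) \<beta> \<and>
    ev (Q s) (inverse \<beta>) = ev (Q t) (inverse \<beta>)"
proof -
  define F where "F = {x :: 'f. x ^ (3 ^ m) = x}"
  define p :: "'f poly" where "p = monom 1 (3 ^ m) - monom 1 1"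
  have "coeff p 1 \<noteq> 0" using n_ge_13 by (simp add: p_def pow3_m)
  then have p0: "p \<noteq> 0" by auto
  have F: "F = {x. poly p x = 0}" by (auto simp: F_def p_def poly_monom)
  have "degree p \<le> 3 ^ m" unfolding p_def
    by (intro degree_diff_le order.trans[OF degree_monom_le]) auto
  then have "card F \<le> 3 ^ m" using card_poly_roots_bound[OF p0] F by simp
  moreover have "finite F" using poly_roots_finite[OF p0] F by simp
  ultimately have card: "finite (F \<times> F)" "card (F \<times> F) \<le> 3 ^ (2 * m)"
    by (auto simp: card_cartesian_product mult_2 power_add intro: mult_mono)
  define f where "f s = (ev (Q s) \<beta>, ev (Q s) (inverse \<beta>))" for s
  have "f ` T \<subseteq> F \<times> F"
    by (auto simp: f_def F_def ev_frobenius power_inverse root_power_pow3_m)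
  then have "card (f ` T) < card T" using card assms(2) card_mono by (metis le_less_trans order.trans)
  then have "\<not> inj_on f T" by (rule pigeonhole)
  then show ?thesis by (auto simp: inj_on_def f_def)
qed

section \<open>The check polynomial\<close>

definition h :: "gf3 poly" where
  "h = lcm (min_poly3 \<beta>) (min_poly3 (\<beta> ^ (2 * n - 1)))"

definition Z :: "'f set" where
  "Z = (\<lambda>i. \<beta> ^ (3 ^ i)) ` {..<m} \<union> (\<lambda>i. inverse \<beta> ^ (3 ^ i)) ` {..<m}"

text \<open>These turn out to be exactly the roots of \<open>xn1\<close>; they are the frequencies
  of the Fourier transform.\<close>

definition R :: "'f set" where
  "R = (\<lambda>t. \<beta> ^ (2 * t + 1)) ` {..<n}"

definition xn1 :: "gf3 poly" where "xn1 = monom 1 n + 1"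

definition g :: "gf3 poly" where "g = xn1 div h"

lemma ev_xn1_root: "odd k \<Longrightarrow> ev xn1 (\<beta> ^ k) = 0"
  by (simp add: xn1_def poly_monom power_mult[symmetric] mult.commute[of k])
    (simp add: power_mult root_power_n)

lemma degree_xn1: "degree xn1 = n"
  unfolding xn1_def using n_ge_13
  by (subst degree_add_eq_left) (auto simp: degree_monom_eq)

lemma xn1_nonzero: "xn1 \<noteq> 0"
  using degree_xn1 n_ge_13 by auto

text \<open>The exponent \<open>2 * n - 1\<close> stands for the inverse of \<open>\<beta>\<close>,
  and \<open>xn1\<close> is the annihilator that shows both elements to be algebraic.\<close>

lemma h_dvd_iff: "h dvd q \<longleftrightarrow> ev q \<beta> = 0 \<and> ev q (inverse \<beta>) = 0"
proof -
  have "ev xn1 \<beta> = 0" "ev xn1 (\<beta> ^ (2 * n - 1)) = 0"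
    using ev_xn1_root[of 1] ev_xn1_root[of "2 * n - 1"] n_ge_13 by simp_all
  then show ?thesis
    unfolding h_def inverse_root using min_poly3_dvd_iff[OF xn1_nonzero] by simp
qed

lemma h_dvd_xn1: "h dvd xn1"
  unfolding h_dvd_iff inverse_root
  using ev_xn1_root[of 1] ev_xn1_root[of "2 * n - 1"] n_ge_13 by simp

lemma h_nonzero: "h \<noteq> 0"
  using h_dvd_xn1 xn1_nonzero by auto

text \<open>Conjugate exponents are so small that the sum of two of them stays below
  \<open>2 * n\<close>; this separates conjugates of \<open>\<beta>\<close> from those of its
  inverse.\<close>

lemma pow3_le: "i < m \<Longrightarrow> 3 * 3 ^ i \<le> 2 * n + 1"
proof -
  assume "i < m"
  then have "(3 :: nat) ^ i \<le> 3 ^ (m - 1)" by (intro power_increasing) auto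
  then show ?thesis using pow3_pred_m by linarith
qed

lemma power_in_Z: "i < m \<Longrightarrow> \<beta> ^ (3 ^ i) \<in> Z" "i < m \<Longrightarrow> inverse \<beta> ^ (3 ^ i) \<in> Z"
  by (auto simp: Z_def)

lemma finite_Z: "finite Z"
  by (simp add: Z_def)

lemma card_Z: "card Z = 2 * m"
proof -
  have inj: "inj_on (\<lambda>i. \<beta> ^ (3 ^ i)) {..<m}"
  proof (rule inj_onI)
    fix i j assume ij: "i \<in> {..<m}" "j \<in> {..<m}" "\<beta> ^ (3 ^ i) = \<beta> ^ (3 ^ j)"
    then have "(3::nat) ^ i = 3 ^ j"
      using pow3_le[of i] pow3_le[of j] n_ge_13 by (intro root_power_inj) auto
    then show "i = j" by simp
  qed
  then have inj': "inj_on (\<lambda>i. inverse \<beta> ^ (3 ^ i)) {..<m}"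
    by (simp add: inj_on_def power_inverse)
  have "\<beta> ^ (3 ^ i) \<noteq> inverse \<beta> ^ (3 ^ j)" if "i < m" "j < m" for i j
  proof
    assume "\<beta> ^ (3 ^ i) = inverse \<beta> ^ (3 ^ j)"
    then have eq: "\<beta> ^ (3 ^ i + 3 ^ j) = 1"
      using root_nonzero by (simp add: power_add power_inverse)
    have "0 < (3::nat) ^ i + 3 ^ j" "(3::nat) ^ i + 3 ^ j < 2 * n"
      using pow3_le[of i] pow3_le[of j] n_ge_13 that by auto
    from root_not_1[OF this] eq show False by (rule notE)
  qed
  then have "(\<lambda>i. \<beta> ^ (3 ^ i)) ` {..<m} \<inter> (\<lambda>i. inverse \<beta> ^ (3 ^ i)) ` {..<m} = {}" by blast
  then have "card Z = card ((\<lambda>i. \<beta> ^ (3 ^ i)) ` {..<m}) + card ((\<lambda>i. inverse \<beta> ^ (3 ^ i)) ` {..<m})"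
    unfolding Z_def by (intro card_Un_disjoint finite_imageI finite_lessThan)
  also have "\<dots> = m + m" unfolding card_image[OF inj] card_image[OF inj'] by simp
  finally show ?thesis by simp
qed

lemma ev_Z: "h dvd q \<Longrightarrow> z \<in> Z \<Longrightarrow> ev q z = 0"
  unfolding h_dvd_iff Z_def by (auto simp flip: ev_frobenius)

lemma degree_h: "degree h = 2 * m"
proof (rule antisym)
  have "Z \<subseteq> {x. ev h x = 0}" using ev_Z by auto
  then show "2 * m \<le> degree h"
    using card_ev_roots[OF h_nonzero] card_mono card_Z by (metis order.trans)
next
  define T where "T = {..<2 * m + 1} \<rightarrow>\<^sub>E (UNIV :: gf3 set)"
  define Q where "Q f = (\<Sum>i<2 * m + 1. monom (f i) i)" for f :: "nat \<Rightarrow> gf3"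
  have "finite T" unfolding T_def by (intro finite_PiE) auto
  have "CARD(gf3) = 3" by (simp add: card_three)
  then have "card T = 3 ^ (2 * m + 1)" by (simp add: T_def card_PiE)
  then have "card T > 3 ^ (2 * m)" by simp
  from syndrome_collision[OF \<open>finite T\<close> this, of Q] obtain s t
    where st: "s \<in> T" "t \<in> T" "s \<noteq> t"
    and "ev (Q s) \<beta> = ev (Q t) \<beta>" "ev (Q s) (inverse \<beta>) = ev (Q t) (inverse \<beta>)"
    by blast
  then have "h dvd Q s - Q t" by (simp add: h_dvd_iff)
  have "\<exists>i. s i \<noteq> t i" using st by auto
  then obtain i where i: "s i \<noteq> t i" by blast
  \<comment> \<open>Members of \<open>T\<close> are extensional, hence agree outside the index
    range.\<close>
  then have "i < 2 * m + 1" using st by (auto simp: T_def PiE_def extensional_def)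
  then have "coeff (Q s - Q t) i \<noteq> 0"
    using i by (simp add: Q_def coeff_sum_monom_lessThan del: lessThan_Suc sum.lessThan_Suc)
  then have "Q s - Q t \<noteq> 0" by auto
  then have "degree h \<le> degree (Q s - Q t)" using \<open>h dvd Q s - Q t\<close> by (simp add: dvd_imp_degree_le)
  also have "\<dots> \<le> 2 * m"
    by (intro degree_le) (simp add: Q_def coeff_sum_monom_lessThan del: lessThan_Suc sum.lessThan_Suc)
  finally show "degree h \<le> 2 * m" .
qed

lemma ev_h_iff: "ev h x = 0 \<longleftrightarrow> x \<in> Z"
proof -
  have "Z = {x. ev h x = 0}"
    using card_ev_roots[OF h_nonzero] card_Z degree_h ev_Z by (intro card_seteq) auto
  then show ?thesis by auto
qed

lemma xn1_eq: "xn1 = g * h"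
  using h_dvd_xn1 by (simp add: g_def)

lemma g_nonzero: "g \<noteq> 0"
  using xn1_eq xn1_nonzero by auto

lemma degree_g: "degree g = n - 2 * m"
  using degree_xn1 degree_h g_nonzero h_nonzero by (simp add: xn1_eq degree_mult_eq)

section \<open>The roots of \<open>x^n + 1\<close> and of the generator polynomial\<close>

lemma inj_on_odd_power: "inj_on (\<lambda>t. \<beta> ^ (2 * t + 1)) {..<n}"
proof (rule inj_onI)
  fix s t assume "s \<in> {..<n}" "t \<in> {..<n}" "\<beta> ^ (2 * s + 1) = \<beta> ^ (2 * t + 1)"
  then show "s = t" using root_power_inj[of "2 * s + 1" "2 * t + 1"] by simp
qed

lemma R_eq: "R = {x. ev xn1 x = 0}"
proof (rule card_seteq)
  show "R \<subseteq> {x. ev xn1 x = 0}"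
  proof
    fix x assume "x \<in> R"
    then obtain t where "x = \<beta> ^ (2 * t + 1)" unfolding R_def by blast
    then show "x \<in> {x. ev xn1 x = 0}" using ev_xn1_root[of "2 * t + 1"] by simp
  qed
  show "card {x. ev xn1 x = 0} \<le> card R"
    using card_ev_roots[OF xn1_nonzero] degree_xn1 inj_on_odd_power
    by (simp add: R_def card_image)
qed (rule card_ev_roots[OF xn1_nonzero])

lemma Z_subset_R: "Z \<subseteq> R"
  unfolding R_eq using ev_Z[OF h_dvd_xn1] by auto

lemma ev_g_outside_Z: "x \<in> R \<Longrightarrow> x \<notin> Z \<Longrightarrow> ev g x = 0"
  using ev_h_iff[of x] unfolding R_eq xn1_eq by simp

text \<open>The elements of \<open>R - Z\<close> already exhaust the \<open>n - 2 * m\<close> roots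
  that the degree of \<open>g\<close> allows.\<close>

lemma ev_g_on_Z:
  assumes "z \<in> Z"
  shows "ev g z \<noteq> 0"
proof
  assume "ev g z = 0"
  then have sub: "insert z (R - Z) \<subseteq> {x. ev g x = 0}" using ev_g_outside_Z by auto
  have "finite R" by (simp add: R_def)
  have "card R = n" using inj_on_odd_power by (simp add: R_def card_image)
  have "card (insert z (R - Z)) = n - 2 * m + 1"
    using assms \<open>finite R\<close> \<open>card R = n\<close> card_Z Z_subset_R finite_Z
    by (simp add: card_Diff_subset)
  moreover have "card (insert z (R - Z)) \<le> n - 2 * m"
    using card_mono[OF card_ev_roots(1)[OF g_nonzero] sub] card_ev_roots(2)[OF g_nonzero] degree_g
    by simp
  ultimately show False by simp
qed

lemma inverse_Z: "inverse x \<in> Z \<longleftrightarrow> x \<in> Z"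
proof -
  have "inverse x \<in> Z" if "x \<in> Z" for x
    using that by (auto simp: Z_def power_inverse)
  from this[of x] this[of "inverse x"] show ?thesis by auto
qed

lemma inverse_R:
  assumes "x \<in> R"
  shows "inverse x \<in> R"
proof -
  from assms obtain t where "x = \<beta> ^ (2 * t + 1)" by (auto simp: R_def)
  then have "inverse x = \<beta> ^ ((2 * n - 1) * (2 * t + 1))"
    by (simp only: power_inverse[symmetric] inverse_root power_mult)
  \<comment> \<open>The exponent may exceed \<open>2 * n\<close>, so membership goes through the
    roots of \<open>xn1\<close> instead of the indexing of \<open>R\<close>.\<close>
  moreover have "odd ((2 * n - 1) * (2 * t + 1))" using n_ge_13 by simp
  ultimately show ?thesis using ev_xn1_root unfolding R_eq by simp
qed

section \<open>The BCH bound and the dual code\<close>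

text \<open>If the weight were at most \<open>w\<close>, the zeros would form a Vandermonde system
  with nodes \<open>\<beta> ^ (2 * i)\<close> for \<open>i\<close> in the support, forcing the
  leading coefficient to vanish. The nodes are distinct because \<open>i < n\<close>.\<close>

lemma bch_bound:
  assumes c: "c \<noteq> 0" "degree c < n"
    and zeros: "\<And>j. j < w \<Longrightarrow> ev c (\<beta> ^ (b + 2 * j)) = 0"
  shows "w < card {i. i < n \<and> coeff c i \<noteq> 0}"
proof (rule ccontr)
  define S where "S = {i. i < n \<and> coeff c i \<noteq> 0}"
  assume "\<not> w < card {i. i < n \<and> coeff c i \<noteq> 0}"
  then have card: "card S \<le> w" by (simp add: S_def)
  have fin: "finite S" by (simp add: S_def)
  have lead: "degree c \<in> S" using c by (simp add: S_def)
  have "emb3 (coeff c (degree c)) * \<beta> ^ (b * degree c) = 0"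
  proof (rule vandermonde_kernel_trivial[OF fin _ _ lead, where x = "\<lambda>i. \<beta> ^ (2 * i)"])
    show "inj_on (\<lambda>i. \<beta> ^ (2 * i)) S"
    proof (rule inj_onI)
      fix i j assume "i \<in> S" "j \<in> S" "\<beta> ^ (2 * i) = \<beta> ^ (2 * j)"
      then show "i = j" using root_power_inj[of "2 * i" "2 * j"] by (simp add: S_def)
    qed
    fix j assume "j < card S"
    then have "0 = ev c (\<beta> ^ (b + 2 * j))" using zeros card by simp
    also have "\<dots> = (\<Sum>i<n. emb3 (coeff c i) * (\<beta> ^ (b + 2 * j)) ^ i)"
      using c by (rule_tac ev_altdef)
    also have "\<dots> = (\<Sum>i\<in>S. emb3 (coeff c i) * (\<beta> ^ (b + 2 * j)) ^ i)"
      by (rule sum.mono_neutral_right) (auto simp: S_def)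
    also have "\<dots> = (\<Sum>i\<in>S. emb3 (coeff c i) * \<beta> ^ (b * i) * (\<beta> ^ (2 * i)) ^ j)"
      by (simp add: algebra_simps flip: power_mult power_add)
    finally show "(\<Sum>i\<in>S. emb3 (coeff c i) * \<beta> ^ (b * i) * (\<beta> ^ (2 * i)) ^ j) = 0" by simp
  qed
  then show False using c root_nonzero by simp
qed

text \<open>Summing over odd powers gives \<open>y\<close> times a geometric series with ratio
  \<open>y\<^sup>2\<close>, an \<open>n\<close>-th root of unity that equals 1 only for
  \<open>i = j\<close>.\<close>

lemma orthogonality:
  assumes "i < n" "j < n"
  shows "(\<Sum>x\<in>R. x ^ i * inverse x ^ j) = (if i = j then of_nat n else 0)"
proof -
  define y where "y = \<beta> ^ i * inverse \<beta> ^ j"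
  have "(\<Sum>x\<in>R. x ^ i * inverse x ^ j) = (\<Sum>t<n. y ^ (2 * t + 1))"
    unfolding R_def y_def by (subst sum.reindex[OF inj_on_odd_power])
      (simp add: power_mult_distrib power_inverse mult.commute flip: power_mult power_add power_Suc)
  also have "\<dots> = y * (\<Sum>t<n. (y\<^sup>2) ^ t)"
    by (simp add: sum_distrib_left power_mult)
  also have "\<dots> = (if i = j then of_nat n else 0)"
  proof (cases "i = j")
    case True
    then have "y = 1" using root_nonzero by (simp add: y_def power_inverse)
    then show ?thesis using True by simp
  next
    case False
    have "y\<^sup>2 \<noteq> 1"
    proof
      assume "y\<^sup>2 = 1"
      then have "\<beta> ^ (2 * i) = \<beta> ^ (2 * j)"
        using root_nonzero
        by (simp add: y_def power_mult_distrib power_inverse field_simps flip: power_mult)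
      then show False using root_power_inj[of "2 * i" "2 * j"] assms False by simp
    qed
    moreover have "(y\<^sup>2) ^ n = 1"
    proof -
      have "(y\<^sup>2) ^ n = (\<beta> ^ (2 * n)) ^ i * inverse ((\<beta> ^ (2 * n)) ^ j)"
        by (simp add: y_def power_mult_distrib power_inverse mult_ac flip: power_mult)
      then show ?thesis by (simp add: root_power_2n)
    qed
    ultimately show ?thesis using False by (simp add: sum_gp_strict)
  qed
  finally show ?thesis .
qed

lemma parseval:
  assumes "degree c < n" "degree c' < n"
  shows "(\<Sum>x\<in>R. ev c x * ev c' (inverse x)) =
    of_nat n * emb3 (\<Sum>i<n. coeff c i * coeff c' i)"
proof -
  have "(\<Sum>x\<in>R. ev c x * ev c' (inverse x)) =
    (\<Sum>x\<in>R. \<Sum>i<n. \<Sum>j<n. emb3 (coeff c i) * emb3 (coeff c' j) * (x ^ i * inverse x ^ j))"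
    unfolding ev_altdef[OF assms(1)] ev_altdef[OF assms(2)]
    by (simp add: sum_product mult_ac)
  also have "\<dots> = (\<Sum>i<n. \<Sum>j<n. \<Sum>x\<in>R. emb3 (coeff c i) * emb3 (coeff c' j) * (x ^ i * inverse x ^ j))"
    by (subst sum.swap, rule sum.cong[OF refl], subst sum.swap, rule refl)
  also have "\<dots> = (\<Sum>i<n. \<Sum>j<n. emb3 (coeff c i) * emb3 (coeff c' j) * (if i = j then of_nat n else 0))"
    by (intro sum.cong refl) (simp add: orthogonality flip: sum_distrib_left)
  also have "\<dots> = (\<Sum>i<n. emb3 (coeff c i) * emb3 (coeff c' i) * of_nat n)"
    by (simp add: if_distrib cong: if_cong)
  also have "\<dots> = of_nat n * emb3 (\<Sum>i<n. coeff c i * coeff c' i)"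
    by (simp add: hom_distribs sum_distrib_left mult_ac)
  finally show ?thesis .
qed

text \<open>Since 3 divides \<open>2 * n + 1\<close>, it cannot divide \<open>n\<close>. This allows
  the factor \<open>n\<close> in \<open>parseval\<close> to be cancelled.\<close>

lemma of_nat_n_nonzero: "(of_nat n :: 'f) \<noteq> 0"
proof
  assume "(of_nat n :: 'f) = 0"
  then have "3 dvd n" by (simp add: of_nat_eq_0_iff_char_dvd char_3)
  moreover have "3 dvd 2 * n + 1" using pow3_pred_m by (metis dvd_triv_left)
  ultimately show False by presburger
qed

lemma code_eq: "negacyclic_code n h = {c. g dvd c \<and> degree c < n}"
  unfolding g_def xn1_def
  using n_ge_13 h_dvd_xn1 by (intro negacyclic_code_eq_multiples) (auto simp: xn1_def)

text \<open>By Parseval only the spectral values on \<open>Z\<close> contribute to the inner product of a word with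
  a codeword, and \<open>Z\<close> is closed under inversion; this is why the dual has the zeros \<open>Z\<close> rather than
  their reciprocals.\<close>

lemma dual_code_eq: "dual_code n (negacyclic_code n h) = {c. h dvd c \<and> degree c < n}"
proof (intro Set.set_eqI iffI)
  fix c assume c: "c \<in> {c. h dvd c \<and> degree c < n}"
  have "(\<Sum>i<n. coeff c i * coeff c' i) = 0" if c': "g dvd c'" "degree c' < n" for c'
  proof -
    have "ev c x * ev c' (inverse x) = 0" if "x \<in> R" for x
    proof (cases "x \<in> Z")
      case True
      then show ?thesis using ev_Z c by simp
    next
      case False
      then have "ev g (inverse x) = 0" using that
        by (intro ev_g_outside_Z) (auto simp: inverse_R inverse_Z)
      then show ?thesis using ev_dvd[OF c'(1)] by simp
    qed
    then have "(\<Sum>x\<in>R. ev c x * ev c' (inverse x)) = 0" by (intro sum.neutral) auto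
    then show ?thesis using parseval[of c c'] c c' of_nat_n_nonzero by simp
  qed
  then show "c \<in> dual_code n (negacyclic_code n h)"
    using c by (simp add: dual_code_def code_eq)
next
  fix c assume "c \<in> dual_code n (negacyclic_code n h)"
  then have deg: "degree c < n"
    and ortho: "\<And>c'. g dvd c' \<Longrightarrow> degree c' < n \<Longrightarrow> (\<Sum>i<n. coeff c i * coeff c' i) = 0"
    by (auto simp: dual_code_def code_eq)
  have "ev c z = 0" if z: "z \<in> Z" for z
  proof -
    \<comment> \<open>Orthogonality to the \<open>2 * m\<close> codewords
      \<open>g * monom 1 j\<close> supplies the moments of a Vandermonde system whose nodes are the
      inverses of the elements of \<open>Z\<close>.\<close>
    have "ev c z * ev g (inverse z) = 0"
    proof (rule vandermonde_kernel_trivial[OF finite_Z _ _ z, where x = inverse])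
      fix j assume "j < card Z"
      then have deg': "degree (g * monom 1 j) < n"
        using g_nonzero degree_g card_Z m_less_n by (simp add: degree_mult_eq degree_monom_eq)
      have "0 = (\<Sum>x\<in>R. ev c x * ev (g * monom 1 j) (inverse x))"
        using parseval[OF deg deg'] ortho[OF _ deg'] by simp
      also have "\<dots> = (\<Sum>x\<in>Z. ev c x * ev (g * monom 1 j) (inverse x))"
      proof (rule sum.mono_neutral_right[OF _ Z_subset_R])
        show "finite R" by (simp add: R_def)
        show "\<forall>x\<in>R - Z. ev c x * ev (g * monom 1 j) (inverse x) = 0"
          using ev_g_outside_Z[OF inverse_R] by (simp add: inverse_Z)
      qed
      finally show "(\<Sum>s\<in>Z. ev c s * ev g (inverse s) * inverse s ^ j) = 0"
        by (simp add: poly_monom mult_ac)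
    qed (simp add: inj_on_def)
    then show ?thesis using ev_g_on_Z z inverse_Z by simp
  qed
  moreover have "\<beta> \<in> Z" "inverse \<beta> \<in> Z" using power_in_Z[of 0] m_ge_3 by simp_all
  ultimately show "c \<in> {c. h dvd c \<and> degree c < n}" using deg by (simp add: h_dvd_iff)
qed

section \<open>Parameters\<close>

lemma code_weight:
  assumes c: "g dvd c" "degree c < n" "c \<noteq> 0"
  shows "(3 ^ (m - 1) - 1) div 2 \<le> card {i. i < n \<and> coeff c i \<noteq> 0}"
proof -
  define r :: nat where "r = 3 ^ (m - 1)"
  have "odd r" by (simp add: r_def)
  then obtain w where w: "r = 2 * w + 1" by (elim oddE)
  have r: "3 * r = 2 * n + 1" using pow3_pred_m by (simp add: r_def)
  \<comment> \<open>With \<open>r = 2 * w + 1\<close> there are \<open>w - 1\<close> odd numbers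
    strictly between \<open>r\<close> and \<open>2 * r - 1\<close>. Modulo \<open>2 * n\<close> the
    exponents of \<open>Z\<close> are \<open>3 ^ i\<close>, at most \<open>r\<close>, and
    \<open>2 * n - 3 ^ i\<close>, at least \<open>2 * r - 1\<close>.\<close>
  have "w - 1 < card {i. i < n \<and> coeff c i \<noteq> 0}"
  proof (rule bch_bound[OF c(3,2)])
    fix j assume j: "j < w - 1"
    define k where "k = r + 2 + 2 * j"
    have k: "odd k" "r < k" "k < 2 * r - 1" using j w by (auto simp: k_def)
    have "\<beta> ^ k \<noteq> \<beta> ^ (3 ^ i)" if "i < m" for i
    proof
      assume "\<beta> ^ k = \<beta> ^ (3 ^ i)"
      then have "k = 3 ^ i"
        using k r pow3_le[OF that] by (intro root_power_inj) auto
      then show False using k r pow3_le[OF that] by linarith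
    qed
    moreover have "\<beta> ^ k \<noteq> inverse \<beta> ^ (3 ^ i)" if "i < m" for i
    proof
      assume "\<beta> ^ k = inverse \<beta> ^ (3 ^ i)"
      then have eq: "\<beta> ^ (k + 3 ^ i) = 1"
        using root_nonzero by (simp add: power_add power_inverse)
      have "0 < k + 3 ^ i" "k + 3 ^ i < 2 * n"
        using k r pow3_le[OF that] by auto
      from root_not_1[OF this] eq show False by (rule notE)
    qed
    ultimately have "\<beta> ^ k \<notin> Z" by (auto simp: Z_def)
    then have "ev g (\<beta> ^ k) = 0"
      using ev_xn1_root k by (intro ev_g_outside_Z) (auto simp: R_eq)
    then show "ev c (\<beta> ^ (r + 2 + 2 * j)) = 0" using ev_dvd[OF c(1)] by (simp add: k_def)
  qed
  then show ?thesis unfolding r_def[symmetric] w by simp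
qed

lemma dual_weight:
  assumes c: "h dvd c" "degree c < n" "c \<noteq> 0"
  shows "5 \<le> card {i. i < n \<and> coeff c i \<noteq> 0}"
proof -
  have "4 < card {i. i < n \<and> coeff c i \<noteq> 0}"
  proof (rule bch_bound[OF c(3,2)])
    fix j :: nat assume j: "j < 4"
    have inv3: "inverse \<beta> ^ 3 = \<beta> ^ (2 * n - 3)"
    proof -
      have "\<beta> ^ 3 * \<beta> ^ (2 * n - 3) = 1"
        using root_power_2n n_ge_13 by (simp flip: power_add)
      then show ?thesis by (simp add: inverse_unique power_inverse)
    qed
    \<comment> \<open>The progression -3, -1, 1, 3 starts at \<open>2 * n - 3\<close> to stay in the
      naturals, so its last two exponents wrap around.\<close>
    have e: "\<beta> ^ (2 * n + k) = \<beta> ^ k" for k by (simp add: power_add root_power_2n)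
    have Z: "\<beta> \<in> Z" "inverse \<beta> \<in> Z" "\<beta> ^ 3 \<in> Z" "inverse \<beta> ^ 3 \<in> Z"
      using power_in_Z[of 0] power_in_Z[of 1] m_ge_3 by simp_all
    consider "j = 0" | "j = 1" | "j = 2" | "j = 3" using j by linarith
    then have "\<beta> ^ (2 * n - 3 + 2 * j) \<in> Z"
    proof cases
      case 1
      then have "2 * n - 3 + 2 * j = 2 * n - 3" by simp
      then show ?thesis using Z(4) unfolding inv3 by metis
    next
      case 2
      then have "2 * n - 3 + 2 * j = 2 * n - 1" using n_ge_13 by simp
      then show ?thesis using Z(2) unfolding inverse_root by metis
    next
      case 3
      then have "2 * n - 3 + 2 * j = 2 * n + 1" using n_ge_13 by simp
      then show ?thesis using Z(1) e[of 1] by (metis power_one_right)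
    next
      case 4
      then have "2 * n - 3 + 2 * j = 2 * n + 3" using n_ge_13 by simp
      then show ?thesis using Z(3) e[of 3] by metis
    qed
    then show "ev c (\<beta> ^ (2 * n - 3 + 2 * j)) = 0" by (rule ev_Z[OF c(1)])
  qed
  then show ?thesis by simp
qed

text \<open>The words \<open>a x\<^sup>i + b x\<^sup>j + e\<close> with \<open>a, b \<noteq> 0\<close> outnumber the \<open>3\<^bsup>2m\<^esup>\<close> possible syndromes,
  so two of them differ by a dual codeword of weight at most five. Without the free constant \<open>e\<close>
  the count would not suffice.\<close>

lemma dual_light_word:
  "\<exists>c c'. h dvd c - c' \<and> degree (c - c') < n \<and> c \<noteq> c' \<and>
    card {i. i < n \<and> coeff (c - c') i \<noteq> 0} \<le> 5"
proof -
  define N where "N = (UNIV - {0} :: gf3 set)"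
  \<comment> \<open>The order \<open>j < i\<close>, positive positions and nonzero \<open>a\<close>,
    \<open>b\<close> make the word determine its parameters; position 0 is reserved for
    \<open>e\<close>.\<close>
  define T where "T = (SIGMA i:{1..<n}. {1..<i}) \<times> (N \<times> N) \<times> (UNIV :: gf3 set)"
  define Q where "Q = (\<lambda>((i, j), (a, b), e). monom a i + monom b j + monom e 0 :: gf3 poly)"
  have gf3: "CARD(gf3) = 3" by (simp add: card_three)
  have "card N = 2" unfolding N_def by (subst card_Diff_singleton) (simp_all add: card_three)
  have pairs: "2 * (\<Sum>i\<in>{1..<k}. i - 1) = (k - 1) * (k - 2)" for k :: nat
  proof (induction k)
    case (Suc k)
    show ?case
    proof (cases "k = 0")
      case False
      then obtain l where "k = Suc l" by (cases k) auto
      then show ?thesis using Suc by (cases l) (auto simp: algebra_simps)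
    qed simp
  qed simp
  have "card T = (\<Sum>i\<in>{1..<n}. i - 1) * (2 * 2) * 3"
    unfolding T_def using gf3 \<open>card N = 2\<close>
    by (simp add: card_cartesian_product)
  then have "card T = 6 * ((n - 1) * (n - 2))" using pairs[of n] by simp
  moreover have "(3 :: nat) ^ (2 * m) = (2 * n + 1) * (2 * n + 1)"
    unfolding pow3_m[symmetric] by (simp only: mult_2[of m] power_add)
  \<comment> \<open>This amounts to \<open>2n^2 + 11 > 22n\<close>, which holds from
    \<open>n = 11\<close> on; \<open>m \<ge> 3\<close> gives \<open>n \<ge> 13\<close>.\<close>
  moreover have "(2 * n + 1) * (2 * n + 1) < 6 * ((n - 1) * (n - 2))"
  proof -
    obtain l where l: "n = 13 + l" using n_ge_13 by (metis le_iff_add)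
    show ?thesis unfolding l by (simp add: algebra_simps)
  qed
  ultimately have "card T > 3 ^ (2 * m)" by simp
  moreover have "finite T" by (simp add: T_def N_def)
  ultimately obtain s t where st: "s \<in> T" "t \<in> T" "s \<noteq> t"
    and syn: "ev (Q s) \<beta> = ev (Q t) \<beta>" "ev (Q s) (inverse \<beta>) = ev (Q t) (inverse \<beta>)"
    using syndrome_collision[of T Q] by blast
  have dvd: "h dvd Q s - Q t" using syn by (simp add: h_dvd_iff)
  obtain i j a b e where s: "s = ((i, j), (a, b), e)" by (metis prod.exhaust)
  obtain i' j' a' b' e' where t: "t = ((i', j'), (a', b'), e')" by (metis prod.exhaust)
  have bounds: "0 < j" "j < i" "i < n" "a \<noteq> 0" "b \<noteq> 0" "0 < j'" "j' < i'" "i' < n" "a' \<noteq> 0" "b' \<noteq> 0"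
    using st by (auto simp: s t T_def N_def)
  have coeff_s: "coeff (Q s) k = (if k = i then a else if k = j then b else if k = 0 then e else 0)" for k
    using bounds by (auto simp: Q_def s)
  have coeff_t: "coeff (Q t) k = (if k = i' then a' else if k = j' then b' else if k = 0 then e' else 0)" for k
    using bounds by (auto simp: Q_def t)
  have "Q s \<noteq> Q t"
  proof
    assume "Q s = Q t"
    then have eq: "coeff (Q s) k = coeff (Q t) k" for k by simp
    \<comment> \<open>Both are the largest position with a nonzero coefficient; \<open>j\<close> and
      \<open>j'\<close> are the second largest.\<close>
    have "i = i'"
      using eq[of i] eq[of i'] bounds unfolding coeff_s coeff_t by (auto split: if_splits)
    moreover from this have "j = j'"
      using eq[of j] eq[of j'] bounds unfolding coeff_s coeff_t by (auto split: if_splits)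
    ultimately have "a = a'" "b = b'" "e = e'"
      using eq[of i] eq[of j] eq[of 0] bounds unfolding coeff_s coeff_t by auto
    with \<open>i = i'\<close> \<open>j = j'\<close> show False using st by (simp add: s t)
  qed
  moreover have "degree (Q s - Q t) < n"
  proof -
    have "degree (Q s - Q t) \<le> n - 1"
      using bounds by (intro degree_le) (auto simp: coeff_s coeff_t)
    then show ?thesis using n_ge_13 by simp
  qed
  moreover have "card {k. k < n \<and> coeff (Q s - Q t) k \<noteq> 0} \<le> 5"
  proof -
    \<comment> \<open>The two words share position 0, so five positions suffice instead of
      six.\<close>
    have "{k. k < n \<and> coeff (Q s - Q t) k \<noteq> 0} \<subseteq> set [0, i, j, i', j']"
      by (auto simp: coeff_s coeff_t)
    then have "card {k. k < n \<and> coeff (Q s - Q t) k \<noteq> 0} \<le> card (set [0, i, j, i', j'])"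
      by (intro card_mono) auto
    also have "\<dots> \<le> length [0, i, j, i', j']" by (rule card_length)
    finally show ?thesis by simp
  qed
  ultimately show ?thesis using dvd by blast
qed

lemma code_parameters:
  "code_dim (negacyclic_code n h) = 2 * m"
  "(3 ^ (m - 1) - 1) div 2 \<le> min_dist n (negacyclic_code n h)"
proof -
  have "degree g < n" using degree_g m_less_n m_ge_3 by linarith
  then show "(3 ^ (m - 1) - 1) div 2 \<le> min_dist n (negacyclic_code n h)"
    unfolding code_eq using code_weight g_nonzero by (intro min_dist_ge)
  have "n - degree g = 2 * m" using degree_g m_less_n by linarith
  then show "code_dim (negacyclic_code n h) = 2 * m"
    unfolding code_eq using code_dim_multiples[OF g_nonzero, of n] n_ge_13 by simp
qed

lemma dual_parameters:
  "code_dim (dual_code n (negacyclic_code n h)) = n - 2 * m"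
  "min_dist n (dual_code n (negacyclic_code n h)) = 5"
proof -
  show "code_dim (dual_code n (negacyclic_code n h)) = n - 2 * m"
    unfolding dual_code_eq using code_dim_multiples[OF h_nonzero, of n] degree_h n_ge_13 by simp
  let ?D = "{c. h dvd c \<and> degree c < n}"
  obtain c c' where c: "h dvd c - c'" "degree (c - c') < n" "c \<noteq> c'"
    "card {i. i < n \<and> coeff (c - c') i \<noteq> 0} \<le> 5"
    using dual_light_word by blast
  have "min_dist n ?D \<le> 5"
    using c n_ge_13 by (intro min_dist_le[of "c - c'" _ 0]) (auto simp: hamming_dist_eq_weight)
  moreover have "5 \<le> min_dist n ?D"
    using dual_weight h_nonzero degree_h m_less_n by (intro min_dist_ge) auto
  ultimately show "min_dist n (dual_code n (negacyclic_code n h)) = 5"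
    unfolding dual_code_eq by simp
qed

end

theorem theorem31:
  fixes m :: nat and \<beta> :: "'f::field"
  assumes "m \<ge> 3"
    and "CHAR('f) = 3"
    and "\<beta> ^ (3 ^ m - 1) = 1"
    and "\<forall>k. 0 < k \<and> k < 3 ^ m - 1 \<longrightarrow> \<beta> ^ k \<noteq> 1"
  shows "let n = (3 ^ m - 1) div 2;
             C = negacyclic_code n (lcm (min_poly3 \<beta>) (min_poly3 (\<beta> ^ (2 * n - 1))))
         in code_dim C = 2 * m \<and> min_dist n C \<ge> (3 ^ (m - 1) - 1) div 2 \<and>
            code_dim (dual_code n C) = n - 2 * m \<and> min_dist n (dual_code n C) = 5"
proof -
  interpret primitive_root_char3 m \<beta>
    using assms unfolding primitive_root_char3_def by blast
  show ?thesis
    unfolding Let_def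
    by (intro conjI code_parameters[unfolded h_def n_def] dual_parameters[unfolded h_def n_def])
qed

end
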